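(* A hypergraph $\mathcal E$ has a minimal cover if at least one of the following conditions holds: (1) for any $v\in\bigcup\mathcal E$ the family $\mathcal E_v:=\{E\in\mathcal E:v\in E\}$ is finite; (2) $\sup\{|E|:E\in\mathcal E\}<\omega$ (that is, the cardinalities of the edges are bounded by some fixed finite number).
   Context: A hypergraph is any family (i.e. set) $\mathcal E$ of sets, not necessarily countable; its elements are called edges and the elements of $\bigcup\mathcal E$ are called vertices. A subset $\mathcal C\subseteq\mathcal E$ is a cover of $\mathcal E$ if $\bigcup\mathcal C=\bigcup\mathcal E$. A cover $\mathcal C$ of $\mathcal E$ is minimal if each cover $\mathcal D\subseteq\mathcal C$ of $\mathcal E$ coincides with $\mathcal C$. *)

theory Defs
  imports Main
begin

text \<open>
  A hypergraph is an arbitrary family of sets, i.e. an element of \<^typ>\<open>'a set set\<close>;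
  there is no restriction on its cardinality, and its edges may be infinite or empty.
\<close>

definition is_cover :: "'a set set \<Rightarrow> 'a set set \<Rightarrow> bool" where
  "is_cover \<E> \<C> \<longleftrightarrow> \<C> \<subseteq> \<E> \<and> \<Union>\<C> = \<Union>\<E>"

definition is_minimal_cover :: "'a set set \<Rightarrow> 'a set set \<Rightarrow> bool" where
  "is_minimal_cover \<E> \<C> \<longleftrightarrow>
     is_cover \<E> \<C> \<and> (\<forall>\<D>. \<D> \<subseteq> \<C> \<and> is_cover \<E> \<D> \<longrightarrow> \<D> = \<C>)"

definition edges_at :: "'a set set \<Rightarrow> 'a \<Rightarrow> 'a set set" where
  "edges_at \<E> v = {E \<in> \<E>. v \<in> E}"

text \<open>
  The supremum of the cardinals of the edges is below \<open>\<omega>\<close>.  Finiteness of each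
  edge is required explicitly because \<^const>\<open>card\<close> is \<open>0\<close> on infinite sets.
\<close>

definition bounded_edges :: "'a set set \<Rightarrow> bool" where
  "bounded_edges \<E> \<longleftrightarrow> (\<exists>n::nat. \<forall>E\<in>\<E>. finite E \<and> card E \<le> n)"

end

theory Submission
  imports Defs
begin

text \<open>
  The two conditions call for different arguments, both resting on Zorn's lemma.

  If every vertex lies in only finitely many edges, then the union of a chain of sets of edges
  whose removal leaves a cover again has this property: were all the edges at some vertex
  removed by the union, then, being finitely many, they would already be removed by a single
  member of the chain. A maximal removable set has a minimal cover as its complement.

  If the edges have at most \<open>n\<close> elements, the proof is an induction on \<open>n\<close>. Choose a maximal
  family \<open>\<M>\<close> of pairwise disjoint edges with exactly \<open>n\<close> elements. By maximality, every edge
  of that size meets \<open>\<Union>\<M>\<close>, hence all edges have fewer than \<open>n\<close> elements outside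
  \<open>\<Union>\<M>\<close>. The induction hypothesis provides an irredundant family \<open>\<C>\<close> covering the vertices
  outside \<open>\<Union>\<M>\<close>; add to it those members of \<open>\<M>\<close> that \<open>\<C>\<close> does not
  cover. Nothing becomes redundant: an edge of \<open>\<C>\<close> keeps a vertex of its own outside \<open>\<Union>\<M>\<close>,
  and an added edge contains a vertex missed by \<open>\<C>\<close>, which the other members of \<open>\<M>\<close>
  miss by disjointness. Since the recursion passes to a smaller set of vertices while the
  edges may still stick out of it, the induction is about covering a subset \<open>X\<close> of the
  vertices and measures edges by their traces on \<open>X\<close>
  (lemma \<open>ex_irredundant_cover_of_bounded_traces\<close>).
\<close>

lemma ex_minimal_cover_if_locally_finite:
  assumes fin: "\<And>v. v \<in> \<Union>\<E> \<Longrightarrow> finite (edges_at \<E> v)"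
  shows "\<exists>\<C>. is_minimal_cover \<E> \<C>"
proof -
  define \<A> where "\<A> = {\<R>. \<R> \<subseteq> \<E> \<and> is_cover \<E> (\<E> - \<R>)}"
  have "\<exists>\<M>\<in>\<A>. \<forall>\<R>\<in>\<A>. \<M> \<subseteq> \<R> \<longrightarrow> \<R> = \<M>"
  proof (rule subset_Zorn_nonempty)
    have "{} \<in> \<A>" by (auto simp: \<A>_def is_cover_def)
    then show "\<A> \<noteq> {}" by blast
  next
    fix \<K> assume "\<K> \<noteq> {}" and chain: "subset.chain \<A> \<K>"
    have sub: "\<K> \<subseteq> \<A>" using chain by (simp add: subset_chain_def)
    have "v \<in> \<Union>(\<E> - \<Union>\<K>)" if v: "v \<in> \<Union>\<E>" for v
    proof (rule ccontr)
      assume "v \<notin> \<Union>(\<E> - \<Union>\<K>)"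
      then have "edges_at \<E> v \<subseteq> \<Union>\<K>" by (auto simp: edges_at_def)
      then obtain \<R> where "\<R> \<in> \<K>" "edges_at \<E> v \<subseteq> \<R>"
        using finite_subset_Union_chain[OF fin[OF v] _ \<open>\<K> \<noteq> {}\<close> chain] by blast
      then have "v \<notin> \<Union>(\<E> - \<R>)" "\<R> \<in> \<A>"
        using sub by (auto simp: edges_at_def)
      then show False using v unfolding \<A>_def is_cover_def by blast
    qed
    then show "\<Union>\<K> \<in> \<A>" using sub unfolding \<A>_def is_cover_def by blast
  qed
  then obtain \<M> where \<M>: "\<M> \<in> \<A>" and max: "\<And>\<R>. \<R> \<in> \<A> \<Longrightarrow> \<M> \<subseteq> \<R> \<Longrightarrow> \<R> = \<M>"
    by blast
  have "\<D> = \<E> - \<M>" if \<D>: "\<D> \<subseteq> \<E> - \<M>" "is_cover \<E> \<D>" for \<D>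
  proof -
    have compl: "\<E> - (\<E> - \<D>) = \<D>" using \<D> by blast
    then have "\<E> - \<D> \<in> \<A>" using \<D> by (simp add: \<A>_def)
    moreover have "\<M> \<subseteq> \<E> - \<D>" using \<D> \<M> by (auto simp: \<A>_def)
    ultimately have "\<E> - \<D> = \<M>" by (rule max)
    with compl show ?thesis by simp
  qed
  with \<M> show ?thesis unfolding is_minimal_cover_def \<A>_def by blast
qed

lemma ex_maximal_subfamily_with_disjoint_traces:
  obtains \<M> where "\<M> \<subseteq> \<F>" "pairwise (\<lambda>A B. A \<inter> B \<inter> X = {}) \<M>"
    "\<And>E. E \<in> \<F> \<Longrightarrow> E \<notin> \<M> \<Longrightarrow> \<exists>A\<in>\<M>. E \<inter> A \<inter> X \<noteq> {}"
proof -
  define \<A> where "\<A> = {\<M>. \<M> \<subseteq> \<F> \<and> pairwise (\<lambda>A B. A \<inter> B \<inter> X = {}) \<M>}"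
  have "\<exists>\<M>\<in>\<A>. \<forall>\<N>\<in>\<A>. \<M> \<subseteq> \<N> \<longrightarrow> \<N> = \<M>"
  proof (rule subset_Zorn_nonempty)
    have "{} \<in> \<A>" by (simp add: \<A>_def)
    then show "\<A> \<noteq> {}" by blast
  next
    fix \<K> assume chain: "subset.chain \<A> \<K>"
    have "A \<inter> B \<inter> X = {}" if AB: "A \<in> \<Union>\<K>" "B \<in> \<Union>\<K>" "A \<noteq> B" for A B
    proof -
      obtain \<M> where "\<M> \<in> \<K>" "A \<in> \<M>" "B \<in> \<M>"
        using AB chain unfolding subset_chain_def by blast
      then show ?thesis using AB(3) chain unfolding subset_chain_def \<A>_def pairwise_def by blast
    qed
    moreover have "\<Union>\<K> \<subseteq> \<F>" using chain unfolding subset_chain_def \<A>_def by blast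
    ultimately show "\<Union>\<K> \<in> \<A>" by (simp add: \<A>_def pairwise_def)
  qed
  then obtain \<M> where \<M>: "\<M> \<in> \<A>" and max: "\<And>\<N>. \<N> \<in> \<A> \<Longrightarrow> \<M> \<subseteq> \<N> \<Longrightarrow> \<N> = \<M>"
    by blast
  have "\<exists>A\<in>\<M>. E \<inter> A \<inter> X \<noteq> {}" if E: "E \<in> \<F>" "E \<notin> \<M>" for E
  proof (rule ccontr)
    assume "\<not> (\<exists>A\<in>\<M>. E \<inter> A \<inter> X \<noteq> {})"
    then have "insert E \<M> \<in> \<A>"
      using \<M> E(1) by (auto simp: \<A>_def pairwise_insert)
    with E(2) show False using max by blast
  qed
  with \<M> show thesis using that unfolding \<A>_def by blast
qed

text \<open>
  Irredundancy appears here as the existence, for every chosen edge, of a vertex of \<open>X\<close>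
  covered by no other chosen edge. Such a private vertex survives as long as the edges added
  later avoid it, which is why this form, rather than minimality, passes through the induction.
\<close>

lemma ex_irredundant_cover_of_bounded_traces:
  fixes \<E> :: "'a set set"
  assumes "X \<subseteq> \<Union>\<E>" "\<And>E. E \<in> \<E> \<Longrightarrow> finite (E \<inter> X) \<and> card (E \<inter> X) \<le> n"
  shows "\<exists>\<C>\<subseteq>\<E>. X \<subseteq> \<Union>\<C> \<and> (\<forall>E\<in>\<C>. \<exists>v\<in>E \<inter> X. \<forall>F\<in>\<C>. v \<in> F \<longrightarrow> F = E)"
  using assms
proof (induction n arbitrary: X)
  case 0
  then have "X = {}" by fastforce
  then show ?case by blast
next
  case (Suc n)
  obtain \<M> where \<M>: "\<M> \<subseteq> {E \<in> \<E>. card (E \<inter> X) = Suc n}"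
    and disj: "pairwise (\<lambda>A B. A \<inter> B \<inter> X = {}) \<M>"
    and max: "\<And>E. E \<in> {E \<in> \<E>. card (E \<inter> X) = Suc n} \<Longrightarrow> E \<notin> \<M> \<Longrightarrow>
      \<exists>A\<in>\<M>. E \<inter> A \<inter> X \<noteq> {}"
    using ex_maximal_subfamily_with_disjoint_traces by blast
  define Y where "Y = X - \<Union>\<M>"
  have small: "finite (E \<inter> Y) \<and> card (E \<inter> Y) \<le> n" if E: "E \<in> \<E>" for E
  proof -
    have fin: "finite (E \<inter> X)" and le: "card (E \<inter> X) \<le> Suc n" using Suc.prems(2)[OF E] by auto
    have sub: "E \<inter> Y \<subseteq> E \<inter> X" by (auto simp: Y_def)
    have "card (E \<inter> Y) \<le> n"
    proof (cases "card (E \<inter> X) = Suc n")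
      case True
      \<comment> \<open>A member of \<open>\<M>\<close> meets itself, because its trace is nonempty.\<close>
      then have "\<exists>A\<in>\<M>. E \<inter> A \<inter> X \<noteq> {}"
        using max[of E] E by (cases "E \<in> \<M>") fastforce+
      then have "E \<inter> Y \<subset> E \<inter> X" by (auto simp: Y_def)
      then have "card (E \<inter> Y) < card (E \<inter> X)" by (rule psubset_card_mono[OF fin])
      then show ?thesis using True by simp
    next
      case False
      then show ?thesis using le card_mono[OF fin sub] by linarith
    qed
    then show ?thesis using finite_subset[OF sub fin] by blast
  qed
  have "Y \<subseteq> \<Union>\<E>" using Suc.prems(1) by (auto simp: Y_def)
  then have "\<exists>\<C>\<subseteq>\<E>. Y \<subseteq> \<Union>\<C> \<and> (\<forall>E\<in>\<C>. \<exists>v\<in>E \<inter> Y. \<forall>F\<in>\<C>. v \<in> F \<longrightarrow> F = E)"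
    using small by (rule Suc.IH)
  then obtain \<C> where \<C>: "\<C> \<subseteq> \<E>" "Y \<subseteq> \<Union>\<C>"
    and priv: "\<forall>E\<in>\<C>. \<exists>v\<in>E \<inter> Y. \<forall>F\<in>\<C>. v \<in> F \<longrightarrow> F = E"
    by (elim exE conjE)
  define \<N> where "\<N> = {A \<in> \<M>. \<not> A \<inter> X \<subseteq> \<Union>\<C>}"
  have "\<C> \<union> \<N> \<subseteq> \<E>" using \<C>(1) \<M> by (auto simp: \<N>_def)
  moreover have "X \<subseteq> \<Union>(\<C> \<union> \<N>)"
    using \<C>(2) unfolding Y_def \<N>_def by blast
  moreover have "\<exists>v\<in>E \<inter> X. \<forall>F\<in>\<C> \<union> \<N>. v \<in> F \<longrightarrow> F = E" if "E \<in> \<C> \<union> \<N>" for E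
  proof (cases "E \<in> \<C>")
    case True
    then obtain v where "v \<in> E \<inter> Y" "\<forall>F\<in>\<C>. v \<in> F \<longrightarrow> F = E" using priv by blast
    then show ?thesis unfolding Y_def \<N>_def by blast
  next
    case False
    then have E: "E \<in> \<M>" "\<not> E \<inter> X \<subseteq> \<Union>\<C>" using that by (auto simp: \<N>_def)
    then obtain v where "v \<in> E \<inter> X" "v \<notin> \<Union>\<C>" by blast
    then show ?thesis using E(1) disj unfolding \<N>_def pairwise_def by blast
  qed
  ultimately show ?case by blast
qed

lemma is_minimal_cover_if_private_vertices:
  assumes "is_cover \<E> \<C>"
    and priv: "\<And>E. E \<in> \<C> \<Longrightarrow> \<exists>v\<in>E. \<forall>F\<in>\<C>. v \<in> F \<longrightarrow> F = E"
  shows "is_minimal_cover \<E> \<C>"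
proof -
  have "E \<in> \<D>" if "\<D> \<subseteq> \<C>" "is_cover \<E> \<D>" "E \<in> \<C>" for \<D> E
  proof -
    obtain v where v: "v \<in> E" "\<forall>F\<in>\<C>. v \<in> F \<longrightarrow> F = E" using priv[OF \<open>E \<in> \<C>\<close>] by blast
    then have "v \<in> \<Union>\<D>" using that assms(1) unfolding is_cover_def by blast
    then show ?thesis using v that(1) by blast
  qed
  then show ?thesis using assms(1) unfolding is_minimal_cover_def by blast
qed

theorem proposition3p4:
  fixes \<E> :: "'a set set"
  assumes "(\<forall>v\<in>\<Union>\<E>. finite (edges_at \<E> v)) \<or> bounded_edges \<E>"
  shows "\<exists>\<C>. is_minimal_cover \<E> \<C>"
  using assms
proof
  assume "\<forall>v\<in>\<Union>\<E>. finite (edges_at \<E> v)"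
  then show ?thesis by (intro ex_minimal_cover_if_locally_finite) blast
next
  assume "bounded_edges \<E>"
  then obtain n where n: "\<And>E. E \<in> \<E> \<Longrightarrow> finite E \<and> card E \<le> n"
    unfolding bounded_edges_def by blast
  have "finite (E \<inter> \<Union>\<E>) \<and> card (E \<inter> \<Union>\<E>) \<le> n" if "E \<in> \<E>" for E
  proof -
    have "E \<inter> \<Union>\<E> = E" using that by blast
    then show ?thesis using n[OF that] by simp
  qed
  with subset_refl
  have "\<exists>\<C>\<subseteq>\<E>. \<Union>\<E> \<subseteq> \<Union>\<C> \<and> (\<forall>E\<in>\<C>. \<exists>v\<in>E \<inter> \<Union>\<E>. \<forall>F\<in>\<C>. v \<in> F \<longrightarrow> F = E)"
    by (rule ex_irredundant_cover_of_bounded_traces)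
  then obtain \<C> where \<C>: "\<C> \<subseteq> \<E>" "\<Union>\<E> \<subseteq> \<Union>\<C>"
    and priv: "\<forall>E\<in>\<C>. \<exists>v\<in>E \<inter> \<Union>\<E>. \<forall>F\<in>\<C>. v \<in> F \<longrightarrow> F = E"
    by (elim exE conjE)
  have "is_cover \<E> \<C>" using \<C> unfolding is_cover_def by (simp add: Union_mono subset_antisym)
  moreover have "\<exists>v\<in>E. \<forall>F\<in>\<C>. v \<in> F \<longrightarrow> F = E" if "E \<in> \<C>" for E
    using bspec[OF priv that] by (elim bexE) (intro bexI, auto)
  ultimately have "is_minimal_cover \<E> \<C>" by (rule is_minimal_cover_if_private_vertices)
  then show ?thesis ..
qed

end
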